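(* Let $A$ and $B$ be Banach algebras with bounded approximate identities, and let $(E^{<},E^{>})$ be a Morita equivalence between them. Let $J$ be a closed two-sided ideal of $A$ and $I$ a closed two-sided ideal of $B$. If $$\overline{JE^{>}}=\overline{E^{>}I},$$ then $$\operatorname{Ind}_A^B(J)=I\qquad\text{and}\qquad \operatorname{Ind}_B^A(I)=J.$$
   Context: All Banach spaces and Banach algebras are complex, and all Banach module actions are contractive. For a subset $S$ of a Banach space, $\overline{\operatorname{span}}\,S$ is its closed linear span. For sets $S,T$ a pairing symbol applied to $(S,T)$ denotes the set of all values on $S\times T$; juxtaposition of linear subspaces (e.g. $JE^{>}$, $E^{>}I$) denotes the linear span of all products, and the bar is norm closure. A bounded approximate identity in a Banach algebra $A$ is a net $(u_\lambda)$ with $\sup_\lambda\|u_\lambda\|<\infty$ and $u_\lambda a\to a$, $au_\lambda\to a$ for every $a\in A$. A Morita equivalence $(E^{<},E^{>})$ between Banach algebras $A$ and $B$ consists of a Banach $B$-$A$-bimodule $E^{<}$, a Banach $A$-$B$-bimodule $E^{>}$, and continuous bilinear pairings $\langle\cdot,\cdot\rangle_B:E^{<}\times E^{>}\to B$ and ${}_A\langle\cdot,\cdot\rangle:E^{>}\times E^{<}\to A$ of norm at most one such that, for all $e^{<},f^{<}\in E^{<}$, $e^{>},f^{>}\in E^{>}$, $a\in A$, $b\in B$: (i) $\langle be^{<},e^{>}\rangle_B=b\langle e^{<},e^{>}\rangle_B$, $\langle e^{<},e^{>}b\rangle_B=\langle e^{<},e^{>}\rangle_Bb$, ${}_A\langle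 ae^{>},e^{<}\rangle=a\,{}_A\langle e^{>},e^{<}\rangle$, ${}_A\langle e^{>},e^{<}a\rangle={}_A\langle e^{>},e^{<}\rangle a$; (ii) $\langle e^{<}a,e^{>}\rangle_B=\langle e^{<},ae^{>}\rangle_B$, ${}_A\langle e^{>}b,e^{<}\rangle={}_A\langle e^{>},be^{<}\rangle$; (iii) $\langle e^{<},e^{>}\rangle_Bf^{<}=e^{<}\,{}_A\langle e^{>},f^{<}\rangle$, $e^{>}\langle f^{<},f^{>}\rangle_B={}_A\langle e^{>},f^{<}\rangle f^{>}$; (iv) both pairings are full: $\overline{\operatorname{span}}\,\langle E^{<},E^{>}\rangle_B=B$ and $\overline{\operatorname{span}}\,{}_A\langle E^{>},E^{<}\rangle=A$; (v) all four module actions are nondegenerate, i.e. the linear span of the module products is dense in the module. For a closed two-sided ideal $I$ of $B$ put $E_I^{>}=\{\xi\in E^{>}:\langle\eta,\xi\rangle_B\in I\ \forall\eta\in E^{<}\}$ and $\operatorname{Ind}_B^A(I)=\overline{\operatorname{span}}\,{}_A\langle E_I^{>},E^{<}\rangle$. Symmetrically, for a closed two-sided ideal $J$ of $A$ put $E_J^{<}=\{\eta\in E^{<}:{}_A\langle\xi,\eta\rangle\in J\ \forall\xi\in E^{>}\}$ and $\operatorname{Ind}_A^B(J)=\overline{\operatorname{span}}\,\langle E_J^{<},E^{>}\rangle_B$. *)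

theory Defs
  imports "HOL-Analysis.Analysis"
begin

class complex_vector = real_vector +
  fixes scaleC :: "complex \<Rightarrow> 'a \<Rightarrow> 'a" (infixr "*\<^sub>C" 75)
  assumes scaleR_scaleC: "r *\<^sub>R x = complex_of_real r *\<^sub>C x"
    and scaleC_add_right: "c *\<^sub>C (x + y) = c *\<^sub>C x + c *\<^sub>C y"
    and scaleC_add_left: "(c + d) *\<^sub>C x = c *\<^sub>C x + d *\<^sub>C x"
    and scaleC_scaleC: "c *\<^sub>C (d *\<^sub>C x) = (c * d) *\<^sub>C x"
    and scaleC_one: "1 *\<^sub>C x = x"

class complex_banach = complex_vector + banach +
  assumes norm_scaleC: "norm (c *\<^sub>C x) = cmod c * norm x"

text \<open>Banach algebras are not assumed to be unital.\<close>

class complex_banach_algebra = complex_banach + real_normed_algebra +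
  assumes mult_scaleC_left: "(c *\<^sub>C x) * y = c *\<^sub>C (x * y)"
    and mult_scaleC_right: "x * (c *\<^sub>C y) = c *\<^sub>C (x * y)"

global_interpretation complex_vector:
  vector_space "scaleC :: complex \<Rightarrow> 'a \<Rightarrow> 'a::complex_vector"
  defines csubspace = complex_vector.subspace
    and cspan = complex_vector.span
  by unfold_locales (simp_all add: scaleC_add_right scaleC_add_left scaleC_scaleC scaleC_one)

definition closed_cspan :: "'a::complex_banach set \<Rightarrow> 'a set" where
  "closed_cspan S = closure (cspan S)"

definition closed_ideal :: "'a::complex_banach_algebra set \<Rightarrow> bool" where
  "closed_ideal J \<longleftrightarrow>
     csubspace J \<and> closed J \<and> (\<forall>a. \<forall>j\<in>J. a * j \<in> J \<and> j * a \<in> J)"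

definition directed_preorder :: "'i set \<Rightarrow> ('i \<Rightarrow> 'i \<Rightarrow> bool) \<Rightarrow> bool" where
  "directed_preorder \<Lambda> le \<longleftrightarrow>
     \<Lambda> \<noteq> {} \<and>
     (\<forall>i\<in>\<Lambda>. le i i) \<and>
     (\<forall>i\<in>\<Lambda>. \<forall>j\<in>\<Lambda>. \<forall>k\<in>\<Lambda>. le i j \<longrightarrow> le j k \<longrightarrow> le i k) \<and>
     (\<forall>i\<in>\<Lambda>. \<forall>j\<in>\<Lambda>. \<exists>k\<in>\<Lambda>. le i k \<and> le j k)"

definition tail_filter :: "'i set \<Rightarrow> ('i \<Rightarrow> 'i \<Rightarrow> bool) \<Rightarrow> 'i filter" where
  "tail_filter \<Lambda> le = (INF i\<in>\<Lambda>. principal {j\<in>\<Lambda>. le i j})"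

lemma eventually_tail_filter:
  assumes "directed_preorder \<Lambda> le"
  shows "eventually P (tail_filter \<Lambda> le) \<longleftrightarrow> (\<exists>i\<in>\<Lambda>. \<forall>j\<in>\<Lambda>. le i j \<longrightarrow> P j)"
proof -
  have "\<exists>k\<in>\<Lambda>. principal {l\<in>\<Lambda>. le k l} \<le>
      inf (principal {l\<in>\<Lambda>. le i l}) (principal {l\<in>\<Lambda>. le j l})"
    if ij: "i \<in> \<Lambda>" "j \<in> \<Lambda>" for i j
  proof -
    obtain k where k: "k \<in> \<Lambda>" "le i k" "le j k"
      using assms ij unfolding directed_preorder_def by blast
    have "{l\<in>\<Lambda>. le k l} \<subseteq> {l\<in>\<Lambda>. le i l} \<inter> {l\<in>\<Lambda>. le j l}"
      using assms ij k unfolding directed_preorder_def by blast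
    then show ?thesis using k(1) by auto
  qed
  moreover have "\<Lambda> \<noteq> {}"
    using assms by (simp add: directed_preorder_def)
  ultimately show ?thesis
    unfolding tail_filter_def
    by (subst eventually_INF_base) (auto simp: eventually_principal)
qed

definition bounded_approximate_identity ::
    "'i set \<Rightarrow> ('i \<Rightarrow> 'i \<Rightarrow> bool) \<Rightarrow> ('i \<Rightarrow> 'a::complex_banach_algebra) \<Rightarrow> bool" where
  "bounded_approximate_identity \<Lambda> le u \<longleftrightarrow>
     directed_preorder \<Lambda> le \<and>
     bounded (u ` \<Lambda>) \<and>
     (\<forall>a. ((\<lambda>i. u i * a) \<longlongrightarrow> a) (tail_filter \<Lambda> le)) \<and>
     (\<forall>a. ((\<lambda>i. a * u i) \<longlongrightarrow> a) (tail_filter \<Lambda> le))"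

definition contractive_cbilinear ::
    "('x::complex_banach \<Rightarrow> 'y::complex_banach \<Rightarrow> 'z::complex_banach) \<Rightarrow> bool" where
  "contractive_cbilinear f \<longleftrightarrow>
     (\<forall>x. Vector_Spaces.linear scaleC scaleC (f x)) \<and>
     (\<forall>y. Vector_Spaces.linear scaleC scaleC (\<lambda>x. f x y)) \<and>
     (\<forall>x y. norm (f x y) \<le> norm x * norm y)"

definition banach_bimodule ::
    "('a::complex_banach_algebra \<Rightarrow> 'e::complex_banach \<Rightarrow> 'e) \<Rightarrow>
     ('e \<Rightarrow> 'b::complex_banach_algebra \<Rightarrow> 'e) \<Rightarrow> bool" where
  "banach_bimodule l r \<longleftrightarrow>
     contractive_cbilinear l \<and> contractive_cbilinear r \<and>
     (\<forall>a a' x. l (a * a') x = l a (l a' x)) \<and>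
     (\<forall>x b b'. r x (b * b') = r (r x b) b') \<and>
     (\<forall>a x b. r (l a x) b = l a (r x b))"

text \<open>The type \<open>'l\<close> is the bimodule $E^<$ (left over \<open>'b\<close>, right over \<open>'a\<close>),
  and \<open>'r\<close> is the bimodule $E^>$ (left over \<open>'a\<close>, right over \<open>'b\<close>).\<close>

locale morita_equivalence =
  fixes lB :: "'b::complex_banach_algebra \<Rightarrow> 'l::complex_banach \<Rightarrow> 'l" (infixr "\<rhd>\<^sub>B" 75)
    and rA :: "'l \<Rightarrow> 'a::complex_banach_algebra \<Rightarrow> 'l" (infixl "\<lhd>\<^sub>A" 75)
    and lA :: "'a \<Rightarrow> 'r::complex_banach \<Rightarrow> 'r" (infixr "\<rhd>\<^sub>A" 75)
    and rB :: "'r \<Rightarrow> 'b \<Rightarrow> 'r" (infixl "\<lhd>\<^sub>B" 75)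
    and pB :: "'l \<Rightarrow> 'r \<Rightarrow> 'b" ("\<langle>_, _\<rangle>\<^sub>B")
    and pA :: "'r \<Rightarrow> 'l \<Rightarrow> 'a" ("\<langle>_, _\<rangle>\<^sub>A")
  assumes bimodule_l: "banach_bimodule lB rA"
    and bimodule_r: "banach_bimodule lA rB"
    and pairing_B: "contractive_cbilinear pB"
    and pairing_A: "contractive_cbilinear pA"
    and pB_left: "\<langle>b \<rhd>\<^sub>B x, y\<rangle>\<^sub>B = b * \<langle>x, y\<rangle>\<^sub>B"
    and pB_right: "\<langle>x, y \<lhd>\<^sub>B b\<rangle>\<^sub>B = \<langle>x, y\<rangle>\<^sub>B * b"
    and pA_left: "\<langle>a \<rhd>\<^sub>A y, x\<rangle>\<^sub>A = a * \<langle>y, x\<rangle>\<^sub>A"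
    and pA_right: "\<langle>y, x \<lhd>\<^sub>A a\<rangle>\<^sub>A = \<langle>y, x\<rangle>\<^sub>A * a"
    and pB_balanced: "\<langle>x \<lhd>\<^sub>A a, y\<rangle>\<^sub>B = \<langle>x, a \<rhd>\<^sub>A y\<rangle>\<^sub>B"
    and pA_balanced: "\<langle>y \<lhd>\<^sub>B b, x\<rangle>\<^sub>A = \<langle>y, b \<rhd>\<^sub>B x\<rangle>\<^sub>A"
    and linking_l: "\<langle>x, y\<rangle>\<^sub>B \<rhd>\<^sub>B x' = x \<lhd>\<^sub>A \<langle>y, x'\<rangle>\<^sub>A"
    and linking_r: "y \<lhd>\<^sub>B \<langle>x, y'\<rangle>\<^sub>B = \<langle>y, x\<rangle>\<^sub>A \<rhd>\<^sub>A y'"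
    and full_B: "closed_cspan {\<langle>x, y\<rangle>\<^sub>B | x y. True} = UNIV"
    and full_A: "closed_cspan {\<langle>y, x\<rangle>\<^sub>A | y x. True} = UNIV"
    and nondegenerate_lB: "closed_cspan {b \<rhd>\<^sub>B x | b x. True} = UNIV"
    and nondegenerate_rA: "closed_cspan {x \<lhd>\<^sub>A a | x a. True} = UNIV"
    and nondegenerate_lA: "closed_cspan {a \<rhd>\<^sub>A y | a y. True} = UNIV"
    and nondegenerate_rB: "closed_cspan {y \<lhd>\<^sub>B b | y b. True} = UNIV"

text \<open>With \<open>p\<close> and \<open>q\<close> the pairings of a Morita equivalence, \<open>induced_ideal pB pA I\<close> is
  $\mathrm{Ind}_B^A(I)$, built from $E^>_I$, and \<open>induced_ideal pA pB J\<close> is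
  $\mathrm{Ind}_A^B(J)$, built from $E^<_J$.\<close>

definition ideal_submodule :: "('x \<Rightarrow> 'y \<Rightarrow> 'c) \<Rightarrow> 'c set \<Rightarrow> 'y set" where
  "ideal_submodule p K = {y. \<forall>x. p x y \<in> K}"

definition induced_ideal ::
    "('x \<Rightarrow> 'y \<Rightarrow> 'c) \<Rightarrow> ('y \<Rightarrow> 'x \<Rightarrow> 'd::complex_banach_algebra) \<Rightarrow> 'c set \<Rightarrow> 'd set" where
  "induced_ideal p q K = closed_cspan {q y x | y x. y \<in> ideal_submodule p K}"

end

theory Submission
  imports Defs
begin

text \<open>Applying the pairings to $\overline{JE^>} = \overline{E^>I}$ gives
  ${}_A\langle E^>, IE^<\rangle \subseteq J$ and $\langle E^<, JE^>\rangle_B \subseteq I$, two inclusions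
  exchanged by the symmetry of the Morita equivalence. They determine the induced ideals.
  If $b \in I$, then $b\langle x, y\rangle_B = \langle bx, y\rangle_B$ with $bx \in E^<_J$;
  fullness and the approximate identity ($b \in \overline{bB}$) give $b \in \mathrm{Ind}_A^B(J)$.
  Conversely, if $\eta \in E^<_J$, then $\langle x, y\rangle_B\langle\eta, \xi\rangle_B =
  \langle x, {}_A\langle y, \eta\rangle\xi\rangle_B \in I$, and $c \in \overline{Bc}$ for
  $c = \langle\eta, \xi\rangle_B$.\<close>

lemma clinear_iff:
  "Vector_Spaces.linear scaleC scaleC g \<longleftrightarrow>
    (\<forall>x y. g (x + y) = g x + g y) \<and> (\<forall>c x. g (c *\<^sub>C x) = c *\<^sub>C g x)"
  by (simp add: Vector_Spaces.linear_iff complex_vector.vector_space_axioms)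

lemma contractive_cbilinear_mult:
  "contractive_cbilinear ((*) :: 'a::complex_banach_algebra \<Rightarrow> 'a \<Rightarrow> 'a)"
  unfolding contractive_cbilinear_def
  by (auto intro!: norm_mult_ineq simp: clinear_iff distrib_left distrib_right
      mult_scaleC_left mult_scaleC_right)

text \<open>Real scalars act through \<open>complex_of_real\<close>, so complex linearity gives real
  linearity; this makes the continuity facts for \<open>bounded_linear\<close> available.\<close>

lemma bounded_linear_of_contractive:
  assumes "Vector_Spaces.linear scaleC scaleC g" and "\<And>x. norm (g x) \<le> norm x * K"
  shows "bounded_linear g"
proof -
  interpret g: Vector_Spaces.linear scaleC scaleC g by fact
  show ?thesis
    by (rule bounded_linear_intro[where K = K])
      (auto simp: g.add g.scale scaleR_scaleC assms(2))
qed

lemma contractive_cbilinear_bounded_linear: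
  assumes "contractive_cbilinear f"
  shows "bounded_linear (f x)" and "bounded_linear (\<lambda>x. f x y)"
  using assms unfolding contractive_cbilinear_def
  by (metis bounded_linear_of_contractive mult.commute)+

text \<open>The preimage of \<open>T\<close> under \<open>g\<close> is a closed complex subspace
  containing \<open>S\<close>.\<close>

lemma linear_image_closed_cspan:
  assumes lin: "Vector_Spaces.linear scaleC scaleC g" and cont: "bounded_linear g"
    and T: "csubspace T" "closed T" and S: "\<And>s. s \<in> S \<Longrightarrow> g s \<in> T"
    and x: "x \<in> closed_cspan S"
  shows "g x \<in> T"
proof -
  interpret g: Vector_Spaces.linear scaleC scaleC g by fact
  have "csubspace (g -` T)"
    by (rule complex_vector.subspaceI)
      (auto simp: g.zero g.add g.scale intro: complex_vector.subspace_0[OF T(1)]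
        complex_vector.subspace_add[OF T(1)] complex_vector.subspace_scale[OF T(1)])
  then have "cspan S \<subseteq> g -` T"
    using S by (intro complex_vector.span_minimal) auto
  moreover have "closed (g -` T)"
    using T(2) cont by (simp add: closed_vimage linear_continuous_on)
  ultimately have "closed_cspan S \<subseteq> g -` T"
    unfolding closed_cspan_def by (rule closure_minimal)
  with x show ?thesis by auto
qed

text \<open>Used to check membership on generators only, for multiplication and for both pairings,
  with an ideal or a closed span as \<open>T\<close>.\<close>

lemma contractive_cbilinear_closed_cspan:
  assumes f: "contractive_cbilinear f" and T: "csubspace T" "closed T"
  shows "\<lbrakk>\<And>s. s \<in> S \<Longrightarrow> f s y \<in> T; x \<in> closed_cspan S\<rbrakk> \<Longrightarrow> f x y \<in> T"
    and "\<lbrakk>\<And>s. s \<in> S' \<Longrightarrow> f y' s \<in> T; x' \<in> closed_cspan S'\<rbrakk> \<Longrightarrow> f y' x' \<in> T"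
proof -
  have lin: "Vector_Spaces.linear scaleC scaleC (\<lambda>x. f x y)"
    "Vector_Spaces.linear scaleC scaleC (f y')"
    using f by (auto simp: contractive_cbilinear_def)
  show "f x y \<in> T" if "\<And>s. s \<in> S \<Longrightarrow> f s y \<in> T" "x \<in> closed_cspan S"
    using linear_image_closed_cspan[OF lin(1) contractive_cbilinear_bounded_linear(2)[OF f] T] that
    by blast
  show "f y' x' \<in> T" if "\<And>s. s \<in> S' \<Longrightarrow> f y' s \<in> T" "x' \<in> closed_cspan S'"
    using linear_image_closed_cspan[OF lin(2) contractive_cbilinear_bounded_linear(1)[OF f] T] that
    by blast
qed

lemma csubspace_closed_cspan: "csubspace (closed_cspan S)"
proof (rule complex_vector.subspaceI)
  show "0 \<in> closed_cspan S"
    unfolding closed_cspan_def using closure_subset complex_vector.span_zero by blast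
next
  fix x y assume "x \<in> closed_cspan S" "y \<in> closed_cspan S"
  then obtain f g where fg: "\<And>n::nat. f n \<in> cspan S" "f \<longlonglongrightarrow> x" "\<And>n::nat. g n \<in> cspan S" "g \<longlonglongrightarrow> y"
    unfolding closed_cspan_def closure_sequential by blast
  then have "(\<lambda>n. f n + g n) \<longlonglongrightarrow> x + y" by (intro tendsto_add)
  with fg show "x + y \<in> closed_cspan S"
    unfolding closed_cspan_def closure_sequential
    by (intro exI[of _ "\<lambda>n. f n + g n"]) (simp add: complex_vector.span_add)
next
  fix c :: complex and x assume "x \<in> closed_cspan S"
  then obtain f where f: "\<And>n::nat. f n \<in> cspan S" "f \<longlonglongrightarrow> x"
    unfolding closed_cspan_def closure_sequential by blast
  have "Vector_Spaces.linear scaleC scaleC (\<lambda>x :: 'a. c *\<^sub>C x)"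
    by (simp add: clinear_iff scaleC_add_right scaleC_scaleC mult.commute)
  then have "bounded_linear (\<lambda>x :: 'a. c *\<^sub>C x)"
    by (rule bounded_linear_of_contractive[where K = "cmod c"]) (simp add: norm_scaleC mult.commute)
  then have "(\<lambda>n. c *\<^sub>C f n) \<longlonglongrightarrow> c *\<^sub>C x" using f(2) by (rule bounded_linear.tendsto)
  with f show "c *\<^sub>C x \<in> closed_cspan S"
    unfolding closed_cspan_def closure_sequential
    by (intro exI[of _ "\<lambda>n. c *\<^sub>C f n"]) (simp add: complex_vector.span_scale)
qed

lemma closed_closed_cspan: "closed (closed_cspan S)"
  by (simp add: closed_cspan_def)

lemma subset_closed_cspan: "S \<subseteq> closed_cspan S"
  unfolding closed_cspan_def using closure_subset complex_vector.span_superset by blast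

lemma closed_cspan_minimal:
  assumes "S \<subseteq> T" "csubspace T" "closed T"
  shows "closed_cspan S \<subseteq> T"
  unfolding closed_cspan_def
  using assms by (intro closure_minimal complex_vector.span_minimal)

text \<open>The element \<open>a\<close> is the limit of the products \<open>u i * a\<close> and of
  the products \<open>a * u i\<close>.\<close>

lemma bounded_approximate_identity_mem_closed:
  fixes a :: "'a::complex_banach_algebra"
  assumes bai: "bounded_approximate_identity \<Lambda> le (u :: _ \<Rightarrow> 'a)" and "closed T"
  shows "(\<And>c. c * a \<in> T) \<Longrightarrow> a \<in> T" and "(\<And>c. a * c \<in> T) \<Longrightarrow> a \<in> T"
proof -
  have dir: "directed_preorder \<Lambda> le"
    and lim: "((\<lambda>i. u i * a) \<longlongrightarrow> a) (tail_filter \<Lambda> le)" "((\<lambda>i. a * u i) \<longlongrightarrow> a) (tail_filter \<Lambda> le)"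
    using bai by (auto simp: bounded_approximate_identity_def)
  \<comment> \<open>Every tail contains its own starting index by reflexivity, so limits along the
    filter stay in closed sets.\<close>
  have nt: "tail_filter \<Lambda> le \<noteq> bot"
    using dir unfolding trivial_limit_def eventually_tail_filter[OF dir] directed_preorder_def
    by blast
  show "a \<in> T" if "\<And>c. c * a \<in> T"
    using Lim_in_closed_set[OF \<open>closed T\<close> _ nt lim(1)] that by simp
  show "a \<in> T" if "\<And>c. a * c \<in> T"
    using Lim_in_closed_set[OF \<open>closed T\<close> _ nt lim(2)] that by simp
qed

text \<open>The axioms come in pairs that trade places when A and B, and with them the two modules,
  are exchanged; the two linking identities do so with their sides reversed.\<close>

lemma (in morita_equivalence) swap: "morita_equivalence lA rB lB rA pA pB"
  by unfold_locales
    (fact bimodule_l bimodule_r pairing_B pairing_A pB_left pB_right pA_left pA_right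
      pB_balanced pA_balanced linking_l[symmetric] linking_r[symmetric] linking_l linking_r
      full_B full_A nondegenerate_lB nondegenerate_rA nondegenerate_lA nondegenerate_rB)+

text \<open>The assumptions \<open>IJ\<close> and \<open>JI\<close> trade places under
  \<open>swap\<close>, so this one equality yields both halves of the theorem.\<close>

lemma (in morita_equivalence) induced_ideal_eq:
  assumes bai: "bounded_approximate_identity \<Lambda> le (u :: _ \<Rightarrow> 'b)" and I: "closed_ideal I"
    and IJ: "\<And>b x y. b \<in> I \<Longrightarrow> \<langle>y, b \<rhd>\<^sub>B x\<rangle>\<^sub>A \<in> J"
    and JI: "\<And>a x y. a \<in> J \<Longrightarrow> \<langle>x, a \<rhd>\<^sub>A y\<rangle>\<^sub>B \<in> I"
  shows "induced_ideal pA pB J = I"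
proof
  have subI: "csubspace I" "closed I"
    using I by (auto simp: closed_ideal_def)
  let ?P = "{\<langle>x, y\<rangle>\<^sub>B | x y. True}"
  have "\<langle>\<eta>, \<xi>\<rangle>\<^sub>B \<in> I" if \<eta>: "\<eta> \<in> ideal_submodule pA J" for \<eta> \<xi>
  proof (rule bounded_approximate_identity_mem_closed(1)[OF bai subI(2)])
    fix c
    show "c * \<langle>\<eta>, \<xi>\<rangle>\<^sub>B \<in> I"
    proof (rule contractive_cbilinear_closed_cspan(1)[OF contractive_cbilinear_mult subI, of ?P])
      show "c \<in> closed_cspan ?P" unfolding full_B by (rule UNIV_I)
      fix s assume "s \<in> ?P"
      then obtain x y where s: "s = \<langle>x, y\<rangle>\<^sub>B" by blast
      \<comment> \<open>Both sides equal the pairing of \<open>x\<close> with the right action of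
        \<eta> paired with \<xi> on \<open>y\<close>: the left by \<open>pB_right\<close>, the right
        by \<open>linking_r\<close>.\<close>
      have "s * \<langle>\<eta>, \<xi>\<rangle>\<^sub>B = \<langle>x, \<langle>y, \<eta>\<rangle>\<^sub>A \<rhd>\<^sub>A \<xi>\<rangle>\<^sub>B"
        by (simp add: s flip: pB_right linking_r)
      with \<eta> show "s * \<langle>\<eta>, \<xi>\<rangle>\<^sub>B \<in> I" by (simp add: JI ideal_submodule_def)
    qed
  qed
  then show "induced_ideal pA pB J \<subseteq> I"
    unfolding induced_ideal_def by (intro closed_cspan_minimal subI) auto
next
  let ?P = "{\<langle>x, y\<rangle>\<^sub>B | x y. True}"
  let ?Q = "{\<langle>x, y\<rangle>\<^sub>B | x y. x \<in> ideal_submodule pA J}"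
  show "I \<subseteq> induced_ideal pA pB J"
    unfolding induced_ideal_def
  proof
    fix b assume b: "b \<in> I"
    show "b \<in> closed_cspan ?Q"
    \<comment> \<open>Here \<open>b\<close> has to stay on the left, where \<open>pB_left\<close>
      can absorb it into the first argument of a pairing.\<close>
    proof (rule bounded_approximate_identity_mem_closed(2)[OF bai closed_closed_cspan])
      fix c
      show "b * c \<in> closed_cspan ?Q"
      proof (rule contractive_cbilinear_closed_cspan(2)[OF contractive_cbilinear_mult
            csubspace_closed_cspan closed_closed_cspan, of ?P])
        show "c \<in> closed_cspan ?P" unfolding full_B by (rule UNIV_I)
        fix s assume "s \<in> ?P"
        then obtain x y where s: "s = \<langle>x, y\<rangle>\<^sub>B" by blast
        have "b \<rhd>\<^sub>B x \<in> ideal_submodule pA J"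
          using b by (simp add: ideal_submodule_def IJ)
        then have "\<langle>b \<rhd>\<^sub>B x, y\<rangle>\<^sub>B \<in> ?Q" by blast
        then show "b * s \<in> closed_cspan ?Q"
          using subset_closed_cspan[of ?Q] by (auto simp: s pB_left)
      qed
    qed
  qed
qed

theorem proposition4p1:
  fixes lB :: "'b::complex_banach_algebra \<Rightarrow> 'l::complex_banach \<Rightarrow> 'l"
    and rA :: "'l \<Rightarrow> 'a::complex_banach_algebra \<Rightarrow> 'l"
    and lA :: "'a \<Rightarrow> 'r::complex_banach \<Rightarrow> 'r"
    and rB :: "'r \<Rightarrow> 'b \<Rightarrow> 'r"
    and pB :: "'l \<Rightarrow> 'r \<Rightarrow> 'b"
    and pA :: "'r \<Rightarrow> 'l \<Rightarrow> 'a"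
    and \<Lambda>\<^sub>A :: "'i set" and leA :: "'i \<Rightarrow> 'i \<Rightarrow> bool" and uA :: "'i \<Rightarrow> 'a"
    and \<Lambda>\<^sub>B :: "'j set" and leB :: "'j \<Rightarrow> 'j \<Rightarrow> bool" and uB :: "'j \<Rightarrow> 'b"
    and J :: "'a set" and I :: "'b set"
  assumes "bounded_approximate_identity \<Lambda>\<^sub>A leA uA"
    and "bounded_approximate_identity \<Lambda>\<^sub>B leB uB"
    and "morita_equivalence lB rA lA rB pB pA"
    and "closed_ideal J"
    and "closed_ideal I"
    and "closed_cspan {lA a y | a y. a \<in> J} = closed_cspan {rB y b | y b. b \<in> I}"
  shows "induced_ideal pA pB J = I \<and> induced_ideal pB pA I = J"
proof -
  interpret morita_equivalence lB rA lA rB pB pA by fact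
  interpret swapped: morita_equivalence lA rB lB rA pA pB by (rule swap)
  have J: "csubspace J" "closed J" "\<And>a j. j \<in> J \<Longrightarrow> j * a \<in> J"
    and I: "csubspace I" "closed I" "\<And>b i. i \<in> I \<Longrightarrow> b * i \<in> I"
    using assms(4,5) by (auto simp: closed_ideal_def)
  let ?JE = "{lA a y | a y. a \<in> J}" and ?EI = "{rB y b | y b. b \<in> I}"
  have IJ: "pA y (lB b x) \<in> J" if "b \<in> I" for b x y
  proof -
    \<comment> \<open>One inclusion of the hypothesis on the closed spans. Pairing a generator
      \<open>lA a y'\<close> with \<open>x\<close> gives \<open>a * pA y' x\<close>, which lies in
      \<open>J\<close> as a right ideal.\<close>
    have "rB y b \<in> closed_cspan ?JE"
      using that subset_closed_cspan[of ?EI] unfolding assms(6) by blast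
    then have "pA (rB y b) x \<in> J"
      by (rule contractive_cbilinear_closed_cspan(1)[OF pairing_A J(1,2), rotated])
        (auto simp: pA_left J(3))
    then show ?thesis by (simp add: pA_balanced)
  qed
  have JI: "pB x (lA a y) \<in> I" if "a \<in> J" for a x y
  proof -
    \<comment> \<open>The reverse inclusion; now \<open>pB x (rB y' b) = pB x y' * b\<close> lies in
      \<open>I\<close> as a left ideal.\<close>
    have "lA a y \<in> closed_cspan ?EI"
      using that subset_closed_cspan[of ?JE] unfolding assms(6) by blast
    then show ?thesis
      by (rule contractive_cbilinear_closed_cspan(2)[OF pairing_B I(1,2), rotated])
        (auto simp: pB_right I(3))
  qed
  show ?thesis
    \<comment> \<open>In the swapped equivalence \<open>JI\<close> takes the place of
      \<open>IJ\<close> and conversely.\<close>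
    using induced_ideal_eq[OF assms(2,5) IJ JI] swapped.induced_ideal_eq[OF assms(1,4) JI IJ]
    by blast
qed

end
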